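(* Let $\mathcal{H}$ be a hypermap. Then: (1) $\mathrm{Pin}(\mathcal{H})$ is a bipartite hypermap such that all hypervertices in one $\Delta^{\hat 0}$-orbit have valency $1$; (2) $\mathcal{H}$ is uniform of type $(l;m;n)$ if and only if $\mathrm{Pin}(\mathcal{H})$ is bipartite-uniform of bipartite-type $(1,l;2m;2n)$; (3) $\mathcal{H}$ is regular if and only if $\mathrm{Pin}(\mathcal{H})$ is bipartite-regular.
   Context: A hypermap is a tuple $\mathcal{H}=(\Omega;h_0,h_1,h_2)$, where $\Omega$ is a non-empty finite set (of flags) and $h_0,h_1,h_2$ are fixed-point-free involutory permutations of $\Omega$ (acting on the right) generating a group transitive on $\Omega$. For $\{i,j,k\}=\{0,1,2\}$ the $k$-faces are the $\langle h_i,h_j\rangle$-orbits; $0$-, $1$-, $2$-faces are called hypervertices, hyperedges, hyperfaces. The valency of a $k$-face is half its cardinality. $\mathcal{H}$ is uniform of type $(l;m;n)$ if all hypervertices have valency $l$, all hyperedges $m$, all hyperfaces $n$. Let $\Delta=\langle R_0,R_1,R_2\mid R_0^2=R_1^2=R_2^2=1\rangle$. It acts on $\Omega$ by $R_i\mapsto h_i$; the stabiliser $H$ in $\Delta$ of a flag is a hypermap subgroup of $\mathcal{H}$ (unique up to conjugation), and $\mathcal{H}$ is isomorphic to the set of right cosets $\Delta/_r H$ with $R_0,R_1,R_2$ acting by right multiplication. $\mathcal{H}$ is regular if $H\lhd\Delta$. Write $x^g=g^{-1}xg$. $\Delta^{\hat 0}$ is the normal closure of $\{R_1,R_2\}$ in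 $\Delta$; it has index $2$ and is the free product of the order-two groups generated by $R_1,R_2,R_1^{R_0},R_2^{R_0}$. A hypermap is bipartite if its hypermap subgroup is contained in $\Delta^{\hat 0}$ (its flags then split into two $\Delta^{\hat 0}$-orbits and each hypervertex lies in one of them), and bipartite-regular if its hypermap subgroup is a normal subgroup of $\Delta^{\hat 0}$. A bipartite hypermap is bipartite-uniform of bipartite-type $(l_1,l_2;m;n)$, $l_1\le l_2$, if all hypervertices in one $\Delta^{\hat 0}$-orbit have valency $l_1$, all those in the other have valency $l_2$, all hyperedges have valency $m$ and all hyperfaces valency $n$. $\mathrm{Pin}(\mathcal{H})$ is the hypermap with hypermap subgroup $H\varphi_P^{-1}$ (full preimage), where $\varphi_P:\Delta^{\hat 0}\to\Delta$ is the epimorphism with $R_1\varphi_P=R_1$, $R_2\varphi_P=R_2$, $R_1^{R_0}\varphi_P=R_0$, $R_2^{R_0}\varphi_P=R_0$. *)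

theory Defs
  imports "HOL-Algebra.Group_Action" "HOL-Algebra.Generated_Groups"
begin

section \<open>The group Delta\<close>

datatype idx = I0 | I1 | I2

text \<open>
  \<open>\<Delta> = \<langle>R\<^sub>0, R\<^sub>1, R\<^sub>2 | R\<^sub>0\<^sup>2 = R\<^sub>1\<^sup>2 = R\<^sub>2\<^sup>2 = 1\<rangle>\<close>. The relations make every generator its
  own inverse, so no letters for inverses are needed: the group is the free monoid of words
  in the three indices modulo the congruence generated by \<open>i i = 1\<close>.
\<close>

inductive word_eq :: "idx list \<Rightarrow> idx list \<Rightarrow> bool" where
  refl: "word_eq w w"
| sym: "word_eq u v \<Longrightarrow> word_eq v u"
| trans: "word_eq u v \<Longrightarrow> word_eq v w \<Longrightarrow> word_eq u w"
| rel: "word_eq (u @ [i, i] @ v) (u @ v)"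

lemma equivp_word_eq: "equivp word_eq"
  by (intro equivpI reflpI sympI transpI) (auto intro: word_eq.intros)

quotient_type delta = "idx list" / word_eq
  morphisms rep_delta word
  by (rule equivp_word_eq)

lemma word_eq_append_left: "word_eq u v \<Longrightarrow> word_eq (w @ u) (w @ v)"
proof (induction rule: word_eq.induct)
  case (rel u i v)
  show ?case using word_eq.rel[of "w @ u" i v] by simp
qed (auto intro: word_eq.intros)

lemma word_eq_append_right: "word_eq u v \<Longrightarrow> word_eq (u @ w) (v @ w)"
proof (induction rule: word_eq.induct)
  case (rel u i v)
  show ?case using word_eq.rel[of u i "v @ w"] by simp
qed (auto intro: word_eq.intros)

lift_definition delta_mult :: "delta \<Rightarrow> delta \<Rightarrow> delta" is append
  by (blast intro: word_eq.trans word_eq_append_left word_eq_append_right)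

definition Delta :: "delta monoid" where
  "Delta = \<lparr>carrier = UNIV, mult = delta_mult, one = word []\<rparr>"

definition R :: "idx \<Rightarrow> delta" where
  "R i = word [i]"

lemma carrier_Delta [simp]: "carrier Delta = UNIV"
  by (simp add: Delta_def)

lemma one_Delta: "\<one>\<^bsub>Delta\<^esub> = word []"
  by (simp add: Delta_def)

lemma word_mult: "word u \<otimes>\<^bsub>Delta\<^esub> word v = word (u @ v)"
  by (simp add: Delta_def delta_mult.abs_eq)

lemma word_eq_iff: "word u = word v \<longleftrightarrow> word_eq u v"
  by (rule delta.abs_eq_iff)

lemma word_rep: "word (rep_delta g) = g"
  by (rule Quotient3_abs_rep[OF Quotient3_delta])

lemma word_cases: obtains w where "g = word w"
  by (metis word_rep)

lemma word_eq_rev: "word_eq (rev w @ w) []"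
proof (induction w)
  case (Cons i w)
  have "word_eq (rev w @ [i, i] @ w) (rev w @ w)" by (rule word_eq.rel)
  with Cons show ?case by (auto intro: word_eq.trans)
qed (simp add: word_eq.refl)

lemma group_Delta: "group Delta"
proof (rule groupI)
  fix x y z
  show "x \<otimes>\<^bsub>Delta\<^esub> y \<otimes>\<^bsub>Delta\<^esub> z = x \<otimes>\<^bsub>Delta\<^esub> (y \<otimes>\<^bsub>Delta\<^esub> z)"
    by (cases x rule: word_cases; cases y rule: word_cases; cases z rule: word_cases)
      (simp add: word_mult)
  show "\<one>\<^bsub>Delta\<^esub> \<otimes>\<^bsub>Delta\<^esub> x = x"
    by (cases x rule: word_cases) (simp add: word_mult one_Delta)
  show "\<exists>y\<in>carrier Delta. y \<otimes>\<^bsub>Delta\<^esub> x = \<one>\<^bsub>Delta\<^esub>"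
    by (cases x rule: word_cases)
      (metis UNIV_I carrier_Delta one_Delta word_eq_iff word_eq_rev word_mult)
qed auto

lemma R_square: "R i \<otimes>\<^bsub>Delta\<^esub> R i = \<one>\<^bsub>Delta\<^esub>"
  using word_eq.rel[of "[]" i "[]"] by (simp add: R_def word_mult one_Delta word_eq_iff)

lemma inv_R: "inv\<^bsub>Delta\<^esub> (R i) = R i"
  using group.inv_equality[OF group_Delta R_square] by simp

lemma word_Cons: "word (i # w) = R i \<otimes>\<^bsub>Delta\<^esub> word w"
  by (simp add: R_def word_mult)

definition conj_by :: "('g, 'm) monoid_scheme \<Rightarrow> 'g \<Rightarrow> 'g \<Rightarrow> 'g" where
  "conj_by G x g = inv\<^bsub>G\<^esub> g \<otimes>\<^bsub>G\<^esub> x \<otimes>\<^bsub>G\<^esub> g"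

definition normal_closure :: "('g, 'm) monoid_scheme \<Rightarrow> 'g set \<Rightarrow> 'g set" where
  "normal_closure G S = \<Inter> {N. N \<lhd> G \<and> S \<subseteq> N}"

definition Delta0 :: "delta set" where
  "Delta0 = normal_closure Delta {R I1, R I2}"

abbreviation Delta0_group :: "delta monoid" where
  "Delta0_group \<equiv> Delta\<lparr>carrier := Delta0\<rparr>"

section \<open>Hypermaps\<close>

record 'a hypermap =
  flags :: "'a set"
  perm :: "idx \<Rightarrow> 'a \<Rightarrow> 'a"

text \<open>
  Permutations of the flags are elements of the library group \<open>BijGroup\<close>, i.e. bijections of
  \<open>flags H\<close> that are \<open>undefined\<close> elsewhere. That group multiplies from right to left; this is
  immaterial for the generated subgroups, as inverses are included, and for their orbits.
\<close>

definition monodromy :: "'a hypermap \<Rightarrow> idx set \<Rightarrow> ('a \<Rightarrow> 'a) monoid" where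
  "monodromy H I =
     (BijGroup (flags H))\<lparr>carrier := generate (BijGroup (flags H)) (perm H ` I)\<rparr>"

definition is_hypermap :: "'a hypermap \<Rightarrow> bool" where
  "is_hypermap H \<longleftrightarrow>
     finite (flags H) \<and> flags H \<noteq> {} \<and>
     (\<forall>i. perm H i \<in> carrier (BijGroup (flags H))) \<and>
     (\<forall>i. \<forall>x\<in>flags H. perm H i (perm H i x) = x \<and> perm H i x \<noteq> x) \<and>
     (\<forall>x\<in>flags H. \<forall>y\<in>flags H. \<exists>g\<in>carrier (monodromy H UNIV). g x = y)"

definition faces :: "'a hypermap \<Rightarrow> idx \<Rightarrow> 'a set set" where
  "faces H k = orbits (monodromy H (- {k})) (flags H) (\<lambda>g. g)"

abbreviation hypervertices :: "'a hypermap \<Rightarrow> 'a set set" where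
  "hypervertices H \<equiv> faces H I0"

abbreviation hyperedges :: "'a hypermap \<Rightarrow> 'a set set" where
  "hyperedges H \<equiv> faces H I1"

abbreviation hyperfaces :: "'a hypermap \<Rightarrow> 'a set set" where
  "hyperfaces H \<equiv> faces H I2"

text \<open>A face of a hypermap has even cardinality, so the division below is exact.\<close>

definition valency :: "'a set \<Rightarrow> nat" where
  "valency F = card F div 2"

definition uniform :: "'a hypermap \<Rightarrow> nat \<Rightarrow> nat \<Rightarrow> nat \<Rightarrow> bool" where
  "uniform H l m n \<longleftrightarrow>
     (\<forall>F\<in>hypervertices H. valency F = l) \<and>
     (\<forall>F\<in>hyperedges H. valency F = m) \<and>
     (\<forall>F\<in>hyperfaces H. valency F = n)"

section \<open>The action of Delta and hypermap subgroups\<close>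

text \<open>
  The right action determined by \<open>R i \<mapsto> perm H i\<close>: the letters of a representing word are
  applied from left to right. For a hypermap the result does not depend on the chosen word
  (lemma \<open>act_word\<close>).
\<close>

definition act :: "'a hypermap \<Rightarrow> 'a \<Rightarrow> delta \<Rightarrow> 'a" where
  "act H x g = fold (perm H) (rep_delta g) x"

definition hypermap_subgroup :: "'a hypermap \<Rightarrow> 'a \<Rightarrow> delta set" where
  "hypermap_subgroup H x = stabilizer Delta (\<lambda>g y. act H y g) x"

definition Delta0_orbits :: "'a hypermap \<Rightarrow> 'a set set" where
  "Delta0_orbits H = orbits Delta0_group (flags H) (\<lambda>g y. act H y g)"

lemma perm_in_flags: "is_hypermap H \<Longrightarrow> x \<in> flags H \<Longrightarrow> perm H i x \<in> flags H"
  unfolding is_hypermap_def BijGroup_def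
  using Bij_imp_funcset[of "perm H i" "flags H"] by auto

lemma fold_perm_in_flags: "is_hypermap H \<Longrightarrow> x \<in> flags H \<Longrightarrow> fold (perm H) w x \<in> flags H"
  by (induction w arbitrary: x) (auto simp: perm_in_flags)

lemma fold_perm_cong:
  assumes "is_hypermap H" "word_eq u v"
  shows "x \<in> flags H \<Longrightarrow> fold (perm H) u x = fold (perm H) v x"
  using assms(2)
proof (induction arbitrary: x rule: word_eq.induct)
  case (rel u i v)
  have "perm H i (perm H i (fold (perm H) u x)) = fold (perm H) u x"
    using assms(1) fold_perm_in_flags[OF assms(1) rel] by (auto simp: is_hypermap_def)
  then show ?case by simp
qed auto

lemma act_word:
  assumes "is_hypermap H" "x \<in> flags H"
  shows "act H x (word w) = fold (perm H) w x"
  unfolding act_def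
  by (rule fold_perm_cong[OF assms(1) _ assms(2)]) (metis word_eq_iff word_rep)

lemma act_in_flags: "is_hypermap H \<Longrightarrow> x \<in> flags H \<Longrightarrow> act H x g \<in> flags H"
  by (simp add: act_def fold_perm_in_flags)

lemma act_R: "is_hypermap H \<Longrightarrow> x \<in> flags H \<Longrightarrow> act H x (R i) = perm H i x"
  by (simp add: R_def act_word)

lemma act_one: "is_hypermap H \<Longrightarrow> x \<in> flags H \<Longrightarrow> act H x \<one>\<^bsub>Delta\<^esub> = x"
  by (simp add: one_Delta act_word)

lemma act_mult:
  "is_hypermap H \<Longrightarrow> x \<in> flags H \<Longrightarrow> act H x (g \<otimes>\<^bsub>Delta\<^esub> k) = act H (act H x g) k"
  by (cases g rule: word_cases; cases k rule: word_cases)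
    (simp add: word_mult act_word fold_perm_in_flags)

text \<open>
  The hypermap subgroups of \<open>H\<close> are the stabilisers of its flags; they form one conjugacy class
  in \<open>Delta\<close>. As \<open>Delta0\<close> is normal in \<open>Delta\<close>, each of the following conditions holds for the
  stabiliser of one flag iff it holds for the stabilisers of all flags.
\<close>

definition regular :: "'a hypermap \<Rightarrow> bool" where
  "regular H \<longleftrightarrow> (\<forall>x\<in>flags H. hypermap_subgroup H x \<lhd> Delta)"

definition bipartite :: "'a hypermap \<Rightarrow> bool" where
  "bipartite H \<longleftrightarrow> (\<forall>x\<in>flags H. hypermap_subgroup H x \<subseteq> Delta0)"

definition bipartite_regular :: "'a hypermap \<Rightarrow> bool" where
  "bipartite_regular H \<longleftrightarrow> (\<forall>x\<in>flags H. hypermap_subgroup H x \<lhd> Delta0_group)"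

definition bipartite_uniform :: "'a hypermap \<Rightarrow> nat \<Rightarrow> nat \<Rightarrow> nat \<Rightarrow> nat \<Rightarrow> bool" where
  "bipartite_uniform H l1 l2 m n \<longleftrightarrow>
     bipartite H \<and> l1 \<le> l2 \<and>
     (\<exists>A B. Delta0_orbits H = {A, B} \<and> A \<noteq> B \<and>
        (\<forall>F\<in>hypervertices H. F \<subseteq> A \<longrightarrow> valency F = l1) \<and>
        (\<forall>F\<in>hypervertices H. F \<subseteq> B \<longrightarrow> valency F = l2)) \<and>
     (\<forall>F\<in>hyperedges H. valency F = m) \<and>
     (\<forall>F\<in>hyperfaces H. valency F = n)"

definition coset_hypermap :: "delta set \<Rightarrow> delta set hypermap" where
  "coset_hypermap K =
     \<lparr>flags = rcosets\<^bsub>Delta\<^esub> K, perm = (\<lambda>i. \<lambda>X\<in>rcosets\<^bsub>Delta\<^esub> K. X #>\<^bsub>Delta\<^esub> R i)\<rparr>"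

lemma fold_perm_coset_hypermap:
  assumes "subgroup K Delta"
  shows "fold (perm (coset_hypermap K)) w (K #>\<^bsub>Delta\<^esub> g) = K #>\<^bsub>Delta\<^esub> (g \<otimes>\<^bsub>Delta\<^esub> word w)"
proof (induction w arbitrary: g)
  case Nil
  then show ?case
    using group.is_monoid[OF group_Delta] by (simp flip: one_Delta add: monoid.r_one)
next
  case (Cons i w)
  have "K #>\<^bsub>Delta\<^esub> g \<in> rcosets\<^bsub>Delta\<^esub> K" by (auto simp: RCOSETS_def)
  then have "perm (coset_hypermap K) i (K #>\<^bsub>Delta\<^esub> g) = K #>\<^bsub>Delta\<^esub> (g \<otimes>\<^bsub>Delta\<^esub> R i)"
    by (simp add: coset_hypermap_def group.coset_mult_assoc[OF group_Delta])
  with Cons show ?case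
    using group.is_monoid[OF group_Delta] by (simp add: word_Cons monoid.m_assoc)
qed

lemma hypermap_subgroup_coset_hypermap:
  assumes "subgroup K Delta"
  shows "K \<in> flags (coset_hypermap K)" "hypermap_subgroup (coset_hypermap K) K = K"
proof -
  interpret D: group Delta by (rule group_Delta)
  have K1: "K #>\<^bsub>Delta\<^esub> \<one>\<^bsub>Delta\<^esub> = K" by (simp add: D.coset_mult_one)
  have "K #>\<^bsub>Delta\<^esub> \<one>\<^bsub>Delta\<^esub> \<in> rcosets\<^bsub>Delta\<^esub> K"
    unfolding RCOSETS_def by blast
  then show "K \<in> flags (coset_hypermap K)" by (simp add: K1 coset_hypermap_def)
  have "act (coset_hypermap K) K g = K #>\<^bsub>Delta\<^esub> g" for g
    using fold_perm_coset_hypermap[OF assms, of "rep_delta g" "\<one>\<^bsub>Delta\<^esub>"]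
    by (simp add: act_def K1 word_rep)
  moreover have "K #>\<^bsub>Delta\<^esub> g = K \<longleftrightarrow> g \<in> K" for g
    using assms by (metis D.coset_join1 D.coset_join2 UNIV_I carrier_Delta subset_UNIV)
  ultimately show "hypermap_subgroup (coset_hypermap K) K = K"
    by (simp add: hypermap_subgroup_def stabilizer_def)
qed

section \<open>The epimorphism phi_P and Pin\<close>

definition is_phi_P :: "(delta \<Rightarrow> delta) \<Rightarrow> bool" where
  "is_phi_P \<phi> \<longleftrightarrow>
     \<phi> \<in> extensional Delta0 \<and> \<phi> \<in> epi Delta0_group Delta \<and>
     \<phi> (R I1) = R I1 \<and> \<phi> (R I2) = R I2 \<and>
     \<phi> (conj_by Delta (R I1) (R I0)) = R I0 \<and>
     \<phi> (conj_by Delta (R I2) (R I0)) = R I0"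

text \<open>Existence and uniqueness are established by lemma \<open>ex1_phi_P\<close> below.\<close>

definition phi_P :: "delta \<Rightarrow> delta" where
  "phi_P = (THE \<phi>. is_phi_P \<phi>)"

text \<open>
  \<open>Pin(H)\<close>, defined from the hypermap subgroup of \<open>H\<close> at the flag \<open>x\<close>; another flag gives an
  isomorphic hypermap.
\<close>

definition Pin :: "'a hypermap \<Rightarrow> 'a \<Rightarrow> delta set hypermap" where
  "Pin H x = coset_hypermap {g \<in> Delta0. phi_P g \<in> hypermap_subgroup H x}"

definition even0 :: "idx list \<Rightarrow> bool" where
  "even0 w \<longleftrightarrow> even (count_list w I0)"

lemma even0_simps [simp]:
  "even0 []" "even0 (i # w) \<longleftrightarrow> (if i = I0 then \<not> even0 w else even0 w)"
  "even0 (u @ v) \<longleftrightarrow> (even0 u \<longleftrightarrow> even0 v)"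
  by (auto simp: even0_def)

lemma even0_cong: "word_eq u v \<Longrightarrow> even0 u \<longleftrightarrow> even0 v"
  by (induction rule: word_eq.induct) auto

lift_definition even_elt :: "delta \<Rightarrow> bool" is even0
  by (rule even0_cong)

lemma even_elt_word [simp]: "even_elt (word w) \<longleftrightarrow> even0 w"
  by (rule even_elt.abs_eq)

lemma even_elt_mult [simp]:
  "even_elt (g \<otimes>\<^bsub>Delta\<^esub> k) \<longleftrightarrow> (even_elt g \<longleftrightarrow> even_elt k)"
  by (cases g rule: word_cases; cases k rule: word_cases) (simp add: word_mult)

lemma even_elt_one [simp]: "even_elt \<one>\<^bsub>Delta\<^esub>"
  by (simp add: one_Delta)

lemma even_elt_inv [simp]: "even_elt (inv\<^bsub>Delta\<^esub> g) \<longleftrightarrow> even_elt g"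
  using even_elt_mult[of "inv\<^bsub>Delta\<^esub> g" g] group.l_inv[OF group_Delta, of g] by simp

lemma even_normal: "{g. even_elt g} \<lhd> Delta"
proof -
  interpret D: group Delta by (rule group_Delta)
  have "subgroup {g. even_elt g} Delta"
    by (rule D.subgroupI) (auto intro: even_elt_one)
  then show ?thesis by (auto simp: D.normal_inv_iff)
qed

definition Delta0_gens :: "delta set" where
  "Delta0_gens =
     {R I1, R I2, conj_by Delta (R I1) (R I0), conj_by Delta (R I2) (R I0)}"

lemma Delta0_normal: "Delta0 \<lhd> Delta"
proof -
  interpret D: group Delta by (rule group_Delta)
  have "{R I1, R I2} \<subseteq> {g. even_elt g}" by (simp add: R_def)
  then have "{N. N \<lhd> Delta \<and> {R I1, R I2} \<subseteq> N} \<noteq> {}" using even_normal by blast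
  then have "subgroup Delta0 Delta"
    unfolding Delta0_def normal_closure_def
    by (intro D.subgroups_Inter) (auto simp: normal_imp_subgroup)
  then show ?thesis
    by (auto simp: D.normal_inv_iff Delta0_def normal_closure_def)
qed

lemma R_in_Delta0: "R I1 \<in> Delta0" "R I2 \<in> Delta0"
  by (auto simp: Delta0_def normal_closure_def)

lemma Delta0_gens_subset: "Delta0_gens \<subseteq> Delta0"
proof -
  interpret D: group Delta by (rule group_Delta)
  have "conj_by Delta g (R I0) \<in> Delta0" if "g \<in> Delta0" for g
    using that Delta0_normal unfolding conj_by_def
    by (metis D.normal_inv_iff UNIV_I carrier_Delta D.inv_inv)
  then show ?thesis using R_in_Delta0 by (auto simp: Delta0_gens_def)
qed

lemma even_in_generate:
  "(even0 w \<longrightarrow> word w \<in> generate Delta Delta0_gens) \<and>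
   (\<not> even0 w \<longrightarrow> word (I0 # w) \<in> generate Delta Delta0_gens)"
proof (induction w)
  case Nil
  then show ?case using generate.one[of Delta Delta0_gens] by (simp add: one_Delta)
next
  case (Cons i w)
  show ?case
  proof (cases "i = I0")
    case True
    have "word (I0 # I0 # w) = word w"
      using word_eq.rel[of "[]" I0 w] by (simp add: word_eq_iff)
    with True Cons show ?thesis by auto
  next
    case False
    have *: "word (I0 # i # w) = word [I0, i, I0] \<otimes>\<^bsub>Delta\<^esub> word (I0 # w)"
      using word_eq.rel[of "[I0, i]" I0 w] by (auto simp: word_mult word_eq_iff intro: word_eq.sym)
    have "word [I0, i, I0] = conj_by Delta (R i) (R I0)"
      by (simp add: conj_by_def inv_R) (simp add: R_def word_mult)
    with False have "word [I0, i, I0] \<in> Delta0_gens" "R i \<in> Delta0_gens"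
      by (cases i; auto simp: Delta0_gens_def)+
    with False Cons * show ?thesis
      by (auto simp: word_Cons[of i w] intro: generate.eng generate.incl)
  qed
qed

lemma mem_Delta0_iff: "g \<in> Delta0 \<longleftrightarrow> even_elt g"
proof
  assume "g \<in> Delta0"
  moreover have "Delta0 \<subseteq> {g. even_elt g}"
    unfolding Delta0_def normal_closure_def using even_normal by (auto simp: R_def)
  ultimately show "even_elt g" by auto
next
  assume "even_elt g"
  then have "g \<in> generate Delta Delta0_gens"
    using even_in_generate by (cases g rule: word_cases) auto
  then show "g \<in> Delta0"
    using group.generate_subgroup_incl[OF group_Delta Delta0_gens_subset
        normal_imp_subgroup[OF Delta0_normal]] by auto
qed

lemma Delta0_eq_generate: "Delta0 = generate Delta Delta0_gens"
proof
  show "Delta0 \<subseteq> generate Delta Delta0_gens"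
  proof
    fix g assume "g \<in> Delta0"
    then show "g \<in> generate Delta Delta0_gens"
      using even_in_generate by (cases g rule: word_cases) (auto simp: mem_Delta0_iff)
  qed
  show "generate Delta Delta0_gens \<subseteq> Delta0"
    by (rule group.generate_subgroup_incl[OF group_Delta Delta0_gens_subset
        normal_imp_subgroup[OF Delta0_normal]])
qed

text \<open>
  \<open>phi_P\<close> on words: the flag \<open>s\<close> records the parity of the number of letters \<open>I0\<close> read so far.
\<close>

fun pin_word :: "bool \<Rightarrow> idx list \<Rightarrow> idx list" where
  "pin_word s [] = []"
| "pin_word s (i # w) =
     (if i = I0 then pin_word (\<not> s) w else (if s then I0 else i) # pin_word s w)"

lemma pin_word_append:
  "pin_word s (u @ v) = pin_word s u @ pin_word (if even0 u then s else \<not> s) v"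
  by (induction u arbitrary: s) auto

lemma pin_word_cong: "word_eq u v \<Longrightarrow> word_eq (pin_word s u) (pin_word s v)"
proof (induction arbitrary: s rule: word_eq.induct)
  case (rel u i v)
  define t where "t = (if even0 u then s else \<not> s)"
  have "word_eq (pin_word s u @ pin_word t ([i, i] @ v)) (pin_word s u @ pin_word t v)"
  proof (rule word_eq_append_left)
    show "word_eq (pin_word t ([i, i] @ v)) (pin_word t v)"
      using word_eq.rel[of "[]" _ "pin_word t v"] by (cases i) (auto intro: word_eq.refl)
  qed
  then show ?case by (simp only: pin_word_append[of s] t_def)
qed (auto intro: word_eq.intros)

lift_definition pin_elt :: "delta \<Rightarrow> delta" is "pin_word False"
  by (rule pin_word_cong)

lemma pin_elt_word: "pin_elt (word w) = word (pin_word False w)"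
  by (rule pin_elt.abs_eq)

lemma pin_elt_surj: "\<exists>u. even0 u \<and> pin_word False u = w"
proof (induction w)
  case (Cons i w)
  then obtain u where "even0 u" "pin_word False u = w" by auto
  then show ?case
    by (intro exI[of _ "(if i = I0 then [I0, I1, I0] else [i]) @ u"]) auto
qed (auto intro: exI[of _ "[]"])

lemma is_phi_P_pin_elt: "is_phi_P (restrict pin_elt Delta0)"
proof -
  have "pin_elt (g \<otimes>\<^bsub>Delta\<^esub> k) = pin_elt g \<otimes>\<^bsub>Delta\<^esub> pin_elt k"
    if "even_elt g" "even_elt k" for g k
    using that
    by (cases g rule: word_cases; cases k rule: word_cases)
      (simp add: word_mult pin_elt_word pin_word_append)
  then have "restrict pin_elt Delta0 \<in> hom Delta0_group Delta"
    by (auto simp: hom_def mem_Delta0_iff)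
  moreover have "g \<in> pin_elt ` Delta0" for g
    using pin_elt_surj
    by (cases g rule: word_cases) (metis even_elt_word image_eqI mem_Delta0_iff pin_elt_word)
  ultimately have "restrict pin_elt Delta0 \<in> epi Delta0_group Delta"
    by (auto simp: epi_def)
  moreover have "conj_by Delta (R i) (R I0) = word [I0, i, I0]" for i
    by (simp add: conj_by_def inv_R) (simp add: R_def word_mult)
  ultimately show ?thesis
    by (auto simp: is_phi_P_def mem_Delta0_iff pin_elt_word R_def)
qed

lemma ex1_phi_P: "\<exists>!\<phi>. is_phi_P \<phi>"
proof (rule ex1I[where a = "restrict pin_elt Delta0"])
  show "is_phi_P (restrict pin_elt Delta0)" by (rule is_phi_P_pin_elt)
next
  fix \<phi> assume \<phi>: "is_phi_P \<phi>"
  interpret D: group Delta by (rule group_Delta)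
  have D0: "subgroup Delta0 Delta" by (rule normal_imp_subgroup[OF Delta0_normal])
  have grp: "group Delta0_group" by (rule D.subgroup_imp_group[OF D0])
  let ?\<psi> = "restrict pin_elt Delta0"
  interpret P: group_hom Delta0_group Delta \<phi>
    using \<phi> grp by (auto simp: group_hom_def group_hom_axioms_def is_phi_P_def epi_def)
  interpret Q: group_hom Delta0_group Delta ?\<psi>
    using is_phi_P_pin_elt grp
    by (auto simp: group_hom_def group_hom_axioms_def is_phi_P_def epi_def)
  have gens: "\<phi> g = ?\<psi> g" if "g \<in> Delta0_gens" for g
    using that \<phi> is_phi_P_pin_elt unfolding is_phi_P_def Delta0_gens_def by auto
  have "\<phi> g = ?\<psi> g" if "g \<in> generate Delta Delta0_gens" for g
    using that
  proof (induction rule: generate.induct)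
    case one
    show ?case using P.hom_one Q.hom_one by simp
  next
    case (incl g)
    then show ?case by (rule gens)
  next
    case (inv g)
    then have "g \<in> Delta0" using Delta0_gens_subset by auto
    then show ?case
      using P.hom_inv[of g] Q.hom_inv[of g] gens[OF inv] D.m_inv_consistent[OF D0, of g]
      by (simp del: restrict_apply)
  next
    case (eng g k)
    then have "g \<in> Delta0" "k \<in> Delta0" by (simp_all add: Delta0_eq_generate)
    then show ?case
      using P.hom_mult[of g k] Q.hom_mult[of g k] eng.IH by (simp del: restrict_apply)
  qed
  then show "\<phi> = ?\<psi>"
    using \<phi> by (intro extensionalityI[of _ Delta0])
      (auto simp: is_phi_P_def Delta0_eq_generate simp del: restrict_apply)
qed

lemma is_phi_P_phi_P: "is_phi_P phi_P"
  unfolding phi_P_def by (rule theI'[OF ex1_phi_P])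

text \<open>Hypervertices do not straddle \<open>Delta0\<close>-orbits, as \<open>bipartite_uniform\<close> presupposes.\<close>

lemma perm_inv_BijGroup:
  assumes "is_hypermap H"
  shows "inv\<^bsub>BijGroup (flags H)\<^esub> (perm H i) = perm H i"
proof (rule group.inv_equality[OF group_BijGroup])
  have B: "perm H i \<in> Bij (flags H)"
    using assms by (simp add: is_hypermap_def BijGroup_def)
  then show "perm H i \<in> carrier (BijGroup (flags H))" by (simp add: BijGroup_def)
  then show "perm H i \<in> carrier (BijGroup (flags H))" .
  have "compose (flags H) (perm H i) (perm H i) = (\<lambda>x\<in>flags H. x)"
    using assms by (intro ext) (simp add: is_hypermap_def compose_def)
  with B show "perm H i \<otimes>\<^bsub>BijGroup (flags H)\<^esub> perm H i = \<one>\<^bsub>BijGroup (flags H)\<^esub>"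
    by (simp add: BijGroup_def)
qed

lemma monodromy_fold:
  assumes H: "is_hypermap H" and "g \<in> carrier (monodromy H I)"
  shows "\<exists>w. set w \<subseteq> I \<and> (\<forall>x\<in>flags H. g x = fold (perm H) w x)"
proof -
  have B: "perm H i \<in> carrier (BijGroup (flags H))" for i
    using H by (simp add: is_hypermap_def)
  have "g \<in> generate (BijGroup (flags H)) (perm H ` I)"
    using assms(2) by (simp add: monodromy_def)
  then show ?thesis
  proof (induction rule: generate.induct)
    case one
    show ?case by (intro exI[of _ "[]"]) (simp add: BijGroup_def)
  next
    case (incl g)
    then obtain i where "i \<in> I" "g = perm H i" by auto
    then show ?case by (intro exI[of _ "[i]"]) simp
  next
    case (inv g)
    then obtain i where "i \<in> I" "g = perm H i" by auto
    then show ?case by (intro exI[of _ "[i]"]) (simp add: perm_inv_BijGroup[OF H])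
  next
    case (eng g k)
    then obtain u v where u: "set u \<subseteq> I" "\<forall>x\<in>flags H. g x = fold (perm H) u x"
      and v: "set v \<subseteq> I" "\<forall>x\<in>flags H. k x = fold (perm H) v x" by auto
    have "g \<in> Bij (flags H)" "k \<in> Bij (flags H)"
      using eng.hyps group.generate_in_carrier[OF group_BijGroup, of "perm H ` I" "flags H"] B
      by (auto simp: BijGroup_def)
    then have "(g \<otimes>\<^bsub>BijGroup (flags H)\<^esub> k) x = fold (perm H) (v @ u) x" if "x \<in> flags H" for x
      using that u v by (simp add: BijGroup_def compose_def fold_perm_in_flags[OF H])
    with u v show ?case by (intro exI[of _ "v @ u"]) auto
  qed
qed

lemma hypervertex_in_Delta0_orbit:
  assumes H: "is_hypermap H" and "F \<in> hypervertices H"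
  shows "\<exists>A\<in>Delta0_orbits H. F \<subseteq> A"
proof -
  obtain x where x: "x \<in> flags H" and F: "F = orbit (monodromy H (- {I0})) (\<lambda>g. g) x"
    using assms(2) by (auto simp: faces_def orbits_def)
  have "g x \<in> orbit Delta0_group (\<lambda>g y. act H y g) x" if g: "g \<in> carrier (monodromy H (- {I0}))" for g
  proof -
    obtain w where w: "set w \<subseteq> - {I0}" "g x = fold (perm H) w x"
      using monodromy_fold[OF H g] x by auto
    from w(1) have "I0 \<notin> set w" by auto
    then have "word w \<in> Delta0" by (simp add: mem_Delta0_iff even0_def count_list_0_iff)
    with w(2) show ?thesis using act_word[OF H x, of w] unfolding orbit_def by force
  qed
  then have "F \<subseteq> orbit Delta0_group (\<lambda>g y. act H y g) x" unfolding F orbit_def[of "monodromy _ _"] by auto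
  with x show ?thesis unfolding Delta0_orbits_def orbits_def by blast
qed

end

theory Submission
  imports Defs
begin

text \<open>
  Up to isomorphism, \<open>Pin(H)\<close> is a hypermap on two copies ("sheets") of the flags of \<open>H\<close>. Let \<open>K\<close>
  be the preimage under \<open>phi_P\<close> of the stabiliser of \<open>x\<close>. Since \<open>\<Delta> = \<Delta>\<^sup>0 \<union> \<Delta>\<^sup>0 R\<^sub>0\<close>, with
  \<open>\<Delta>\<^sup>0\<close> denoting \<open>Delta0\<close>, every coset of \<open>K\<close> is \<open>K g\<close> or \<open>K g R\<^sub>0\<close> with \<open>g\<close> in \<open>\<Delta>\<^sup>0\<close>, and both
  are determined by their kind and the flag \<open>x phi_P(g)\<close>. On the two sheets \<open>R\<^sub>0\<close> exchanges the
  copies of a flag; \<open>R\<^sub>1\<close> and \<open>R\<^sub>2\<close> act on the first sheet as they do on \<open>H\<close>, and on the second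
  sheet both act as \<open>R\<^sub>0\<close> does on \<open>H\<close>. This is \<open>pin_model\<close>, and \<open>hypermap_iso_Pin\<close> identifies
  it with \<open>Pin(H)\<close>: its stabiliser at the first copy of \<open>x\<close> is \<open>K\<close>, and a hypermap is
  isomorphic to the hypermap of cosets of any of its flag stabilisers.

  The claims can now be read off the model. The sheets are the \<open>\<Delta>\<^sup>0\<close>-orbits, since exactly the odd
  elements exchange them. Hypervertices stay within a sheet: on the first they are those of \<open>H\<close>,
  on the second they are pairs \<open>{y, y R\<^sub>0}\<close>, of valency \<open>1\<close>. A hyperedge or hyperface consists of
  both copies of one of \<open>H\<close>, so its valency doubles (\<open>face_at_pin_model\<close>).

  For regularity, normality of all stabilisers in a group \<open>G\<close> containing them means that flags in
  one \<open>G\<close>-orbit have comparable, hence equal, stabilisers. An element of \<open>\<Delta>\<^sup>0\<close> acts on each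
  sheet through a word in \<open>R\<^sub>0, R\<^sub>1, R\<^sub>2\<close> acting on \<open>H\<close>, so regularity of \<open>H\<close> passes to both
  sheets; the converse uses the first sheet and the surjectivity of \<open>phi_P\<close>.
\<close>

section \<open>Faces, transitivity and normality in terms of words\<close>

text \<open>
  This needs only that the generators are bijections, because it serves to establish the
  transitivity that is part of being a hypermap.
\<close>

lemma bij_fold_in_monodromy:
  assumes "\<forall>i. perm H i \<in> carrier (BijGroup (flags H))" and "set w \<subseteq> I"
  shows "\<exists>g\<in>carrier (monodromy H I). \<forall>x\<in>flags H. g x = fold (perm H) w x"
  using assms(2)
proof (induction w)
  case Nil
  show ?case
    by (intro bexI[of _ "\<one>\<^bsub>BijGroup (flags H)\<^esub>"])
      (auto simp: monodromy_def generate.one, simp add: BijGroup_def)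
next
  case (Cons i w)
  let ?B = "BijGroup (flags H)"
  from Cons obtain g where g: "g \<in> generate ?B (perm H ` I)"
    and gw: "\<forall>x\<in>flags H. g x = fold (perm H) w x"
    by (auto simp: monodromy_def)
  have i: "perm H i \<in> generate ?B (perm H ` I)"
    using Cons.prems by (auto intro: generate.incl)
  have "perm H ` I \<subseteq> carrier ?B" using assms(1) by auto
  then have "g \<in> carrier ?B" "perm H i \<in> carrier ?B"
    using group.generate_in_carrier[OF group_BijGroup] g i by blast+
  then have bij: "g \<in> Bij (flags H)" "perm H i \<in> Bij (flags H)"
    by (simp_all add: BijGroup_def)
  then have "perm H i y \<in> flags H" if "y \<in> flags H" for y
    using that Bij_imp_funcset by blast
  with bij gw have "(g \<otimes>\<^bsub>?B\<^esub> perm H i) y = fold (perm H) (i # w) y" if "y \<in> flags H" for y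
    using that by (simp add: BijGroup_def compose_def)
  with generate.eng[OF g i] show ?case
    by (intro bexI[of _ "g \<otimes>\<^bsub>?B\<^esub> perm H i"]) (auto simp: monodromy_def)
qed

lemma hypermap_transitive:
  assumes "is_hypermap H" "x \<in> flags H" "y \<in> flags H"
  obtains w where "fold (perm H) w x = y"
proof -
  obtain g where "g \<in> carrier (monodromy H UNIV)" "g x = y"
    using assms unfolding is_hypermap_def by blast
  then show ?thesis using monodromy_fold[OF assms(1)] assms(2) that by metis
qed

lemma is_hypermapI:
  assumes "finite (flags H)" "flags H \<noteq> {}"
    and ext: "\<And>i. perm H i \<in> extensional (flags H)"
    and closed: "\<And>i x. x \<in> flags H \<Longrightarrow> perm H i x \<in> flags H"
    and invol: "\<And>i x. x \<in> flags H \<Longrightarrow> perm H i (perm H i x) = x"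
    and fpf: "\<And>i x. x \<in> flags H \<Longrightarrow> perm H i x \<noteq> x"
    and trans: "\<And>x y. x \<in> flags H \<Longrightarrow> y \<in> flags H \<Longrightarrow> \<exists>w. fold (perm H) w x = y"
  shows "is_hypermap H"
proof -
  have "bij_betw (perm H i) (flags H) (flags H)" for i
    by (rule bij_betw_byWitness[where f' = "perm H i"]) (auto simp: closed invol)
  then have bij: "\<forall>i. perm H i \<in> carrier (BijGroup (flags H))"
    by (auto simp: BijGroup_def Bij_def ext)
  have "\<exists>g\<in>carrier (monodromy H UNIV). g x = y" if "x \<in> flags H" "y \<in> flags H" for x y
    using trans[OF that] bij_fold_in_monodromy[OF bij, of _ UNIV] that by (metis subset_UNIV)
  with assms bij show ?thesis by (auto simp: is_hypermap_def)
qed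

definition face_at :: "'a hypermap \<Rightarrow> idx \<Rightarrow> 'a \<Rightarrow> 'a set" where
  "face_at H k x = {fold (perm H) w x |w. k \<notin> set w}"

lemma faces_eq_face_at:
  assumes H: "is_hypermap H"
  shows "faces H k = face_at H k ` flags H"
proof -
  have bij: "\<forall>i. perm H i \<in> carrier (BijGroup (flags H))"
    using H by (simp add: is_hypermap_def)
  have "orbit (monodromy H (- {k})) (\<lambda>g. g) x = face_at H k x" if x: "x \<in> flags H" for x
  proof
    show "orbit (monodromy H (- {k})) (\<lambda>g. g) x \<subseteq> face_at H k x"
      using monodromy_fold[OF H, of _ "- {k}"] x by (fastforce simp: orbit_def face_at_def)
    show "face_at H k x \<subseteq> orbit (monodromy H (- {k})) (\<lambda>g. g) x"
    proof
      fix y assume "y \<in> face_at H k x"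
      then obtain w where w: "y = fold (perm H) w x" "set w \<subseteq> - {k}" by (auto simp: face_at_def)
      obtain g where "g \<in> carrier (monodromy H (- {k}))" "g x = fold (perm H) w x"
        using bij_fold_in_monodromy[OF bij w(2)] x by blast
      with w show "y \<in> orbit (monodromy H (- {k})) (\<lambda>g. g) x"
        by (auto simp: orbit_def intro!: exI[of _ g])
    qed
  qed
  then show ?thesis by (auto simp: faces_def orbits_def)
qed

lemma face_at_refl: "x \<in> face_at H k x"
  by (auto simp: face_at_def intro!: exI[of _ "[]"])

lemma face_at_closed: "y \<in> face_at H k x \<Longrightarrow> i \<noteq> k \<Longrightarrow> perm H i y \<in> face_at H k x"
proof -
  assume "y \<in> face_at H k x" "i \<noteq> k"
  then obtain w where "y = fold (perm H) w x" "k \<notin> set w" by (auto simp: face_at_def)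
  with \<open>i \<noteq> k\<close> show ?thesis
    by (auto simp: face_at_def intro!: exI[of _ "w @ [i]"])
qed

lemma face_at_least:
  assumes "x \<in> S" "\<And>y i. y \<in> S \<Longrightarrow> i \<noteq> k \<Longrightarrow> perm H i y \<in> S"
  shows "face_at H k x \<subseteq> S"
proof -
  have "k \<notin> set w \<Longrightarrow> y \<in> S \<Longrightarrow> fold (perm H) w y \<in> S" for w y
    by (induction w arbitrary: y) (auto simp: assms(2))
  with assms(1) show ?thesis by (auto simp: face_at_def)
qed

lemma face_at_subset_flags: "is_hypermap H \<Longrightarrow> x \<in> flags H \<Longrightarrow> face_at H k x \<subseteq> flags H"
  by (rule face_at_least) (auto simp: perm_in_flags)

lemma finite_face_at:
  assumes "is_hypermap H" "x \<in> flags H"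
  shows "finite (face_at H k x)"
  by (rule finite_subset[OF face_at_subset_flags[OF assms]]) (use assms(1) in \<open>simp add: is_hypermap_def\<close>)

lemma even_card_if_fixed_point_free_involution:
  assumes "finite S" "\<And>x. x \<in> S \<Longrightarrow> p x \<in> S \<and> p (p x) = x \<and> p x \<noteq> x"
  shows "even (card S)"
  using assms
proof (induction S rule: finite_psubset_induct)
  case (psubset S)
  show ?case
  proof (cases "S = {}")
    case False
    then obtain a where a: "a \<in> S" by auto
    let ?T = "S - {a, p a}"
    have "even (card ?T)"
    proof (rule psubset.IH)
      show "?T \<subset> S" using a by auto
      fix x assume "x \<in> ?T"
      then show "p x \<in> ?T \<and> p (p x) = x \<and> p x \<noteq> x"
        using psubset.prems[of x] psubset.prems[OF a] by auto
    qed
    moreover have "card S = card ?T + card {a, p a}"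
      using psubset.hyps psubset.prems[OF a] a
      by (subst card_Diff_subset) (auto simp: card_mono Suc_leI card_gt_0_iff)
    moreover have "card {a, p a} = 2" using psubset.prems[OF a] by auto
    ultimately show ?thesis by simp
  qed simp
qed

text \<open>
  Valency is defined by integer division, so doubling a face doubles its valency only because
  the cardinality is even.
\<close>

lemma even_card_face_at:
  assumes H: "is_hypermap H" and x: "x \<in> flags H"
  shows "even (card (face_at H k x))"
proof -
  obtain i where i: "i \<noteq> k" by (metis idx.distinct(1))
  show ?thesis
  proof (rule even_card_if_fixed_point_free_involution[where p = "perm H i"])
    show "finite (face_at H k x)" by (rule finite_face_at[OF H x])
    fix y assume y: "y \<in> face_at H k x"
    then have "y \<in> flags H" using face_at_subset_flags[OF H x] by auto
    with H i y show "perm H i y \<in> face_at H k x \<and> perm H i (perm H i y) = y \<and> perm H i y \<noteq> y"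
      by (auto simp: is_hypermap_def face_at_closed)
  qed
qed

lemma valency_pos:
  assumes H: "is_hypermap H" and x: "x \<in> flags H"
  shows "1 \<le> valency (face_at H k x)"
proof -
  have "card (face_at H k x) \<noteq> 0"
    using finite_face_at[OF H x, of k] face_at_refl[of x H k] by auto
  with even_card_face_at[OF H x, of k] show ?thesis
    unfolding valency_def by presburger
qed

lemma Delta0_orbits_eq:
  "Delta0_orbits H = (\<lambda>x. {act H x g |g. g \<in> Delta0}) ` flags H"
  by (auto simp: Delta0_orbits_def orbits_def orbit_def)

lemma mem_hypermap_subgroup: "g \<in> hypermap_subgroup H x \<longleftrightarrow> act H x g = x"
  by (simp add: hypermap_subgroup_def stabilizer_def)

lemma act_inv:
  assumes "is_hypermap H" "x \<in> flags H"
  shows "act H (act H x g) (inv\<^bsub>Delta\<^esub> g) = x"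
  using assms group.r_inv[OF group_Delta, of g]
  by (simp flip: act_mult add: act_one)

lemma subgroup_hypermap_subgroup:
  assumes "is_hypermap H" "x \<in> flags H"
  shows "subgroup (hypermap_subgroup H x) Delta"
proof (rule group.subgroupI[OF group_Delta])
  show "hypermap_subgroup H x \<noteq> {}"
    using act_one[OF assms] by (auto simp: mem_hypermap_subgroup)
  fix a b assume a: "a \<in> hypermap_subgroup H x"
  then show "inv\<^bsub>Delta\<^esub> a \<in> hypermap_subgroup H x"
    using act_inv[OF assms, of a] by (simp add: mem_hypermap_subgroup)
  assume "b \<in> hypermap_subgroup H x"
  with a show "a \<otimes>\<^bsub>Delta\<^esub> b \<in> hypermap_subgroup H x"
    by (simp add: mem_hypermap_subgroup act_mult[OF assms])
qed simp

text \<open>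
  The stabiliser of \<open>x g\<close> is the conjugate by \<open>g\<close> of the stabiliser of \<open>x\<close>, so normality says
  that stabilisers do not shrink along an orbit of \<open>G\<close>.
\<close>

lemma hypermap_subgroup_normal_iff:
  assumes H: "is_hypermap H" and x: "x \<in> flags H" and G: "subgroup G Delta"
    and sub: "hypermap_subgroup H x \<subseteq> G"
  shows "hypermap_subgroup H x \<lhd> Delta\<lparr>carrier := G\<rparr> \<longleftrightarrow>
    (\<forall>g\<in>G. hypermap_subgroup H x \<subseteq> hypermap_subgroup H (act H x g))"
proof -
  interpret D: group Delta by (rule group_Delta)
  interpret G: group "Delta\<lparr>carrier := G\<rparr>" by (rule D.subgroup_imp_group[OF G])
  have "subgroup (hypermap_subgroup H x) (Delta\<lparr>carrier := G\<rparr>)"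
    by (rule D.subgroup_incl[OF subgroup_hypermap_subgroup[OF H x] G sub])
  moreover have "act H x (g \<otimes>\<^bsub>Delta\<^esub> k \<otimes>\<^bsub>Delta\<^esub> inv\<^bsub>Delta\<^esub> g) = x \<longleftrightarrow>
      act H (act H x g) k = act H x g" for g k
  proof
    assume *: "act H x (g \<otimes>\<^bsub>Delta\<^esub> k \<otimes>\<^bsub>Delta\<^esub> inv\<^bsub>Delta\<^esub> g) = x"
    have "act H (act H x g) k = act H x (g \<otimes>\<^bsub>Delta\<^esub> k \<otimes>\<^bsub>Delta\<^esub> inv\<^bsub>Delta\<^esub> g \<otimes>\<^bsub>Delta\<^esub> g)"
      by (simp add: D.m_assoc act_mult[OF H x])
    also have "\<dots> = act H x g" using * by (simp add: act_mult[OF H x])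
    finally show "act H (act H x g) k = act H x g" .
  next
    assume "act H (act H x g) k = act H x g"
    then show "act H x (g \<otimes>\<^bsub>Delta\<^esub> k \<otimes>\<^bsub>Delta\<^esub> inv\<^bsub>Delta\<^esub> g) = x"
      by (simp add: act_mult[OF H x] act_inv[OF H x])
  qed
  ultimately show ?thesis
    by (auto simp: G.normal_inv_iff D.m_inv_consistent[OF G] mem_hypermap_subgroup subset_iff)
qed

text \<open>
  By transitivity \<open>x g\<close> ranges over all flags, so regularity means that a word fixing one flag
  fixes every flag.
\<close>

lemma regular_iff:
  assumes H: "is_hypermap H"
  shows "regular H \<longleftrightarrow>
    (\<forall>y\<in>flags H. \<forall>z\<in>flags H. \<forall>w. fold (perm H) w y = y \<longrightarrow> fold (perm H) w z = z)"
proof -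
  interpret D: group Delta by (rule group_Delta)
  have full: "Delta\<lparr>carrier := UNIV\<rparr> = Delta" by (simp add: Delta_def)
  have "hypermap_subgroup H y \<lhd> Delta \<longleftrightarrow>
      (\<forall>g. hypermap_subgroup H y \<subseteq> hypermap_subgroup H (act H y g))" if "y \<in> flags H" for y
    using hypermap_subgroup_normal_iff[OF H that, of UNIV] D.subgroup_self unfolding full by simp
  moreover have "(\<forall>g. hypermap_subgroup H y \<subseteq> hypermap_subgroup H (act H y g)) \<longleftrightarrow>
      (\<forall>z\<in>flags H. hypermap_subgroup H y \<subseteq> hypermap_subgroup H z)" if "y \<in> flags H" for y
    by (metis H act_in_flags act_word hypermap_transitive that)
  moreover have "hypermap_subgroup H y \<subseteq> hypermap_subgroup H z \<longleftrightarrow>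
      (\<forall>w. fold (perm H) w y = y \<longrightarrow> fold (perm H) w z = z)"
    if "y \<in> flags H" "z \<in> flags H" for y z
    unfolding subset_iff mem_hypermap_subgroup by (metis H act_word that word_cases)
  ultimately show ?thesis by (auto simp: regular_def)
qed

section \<open>Isomorphic hypermaps\<close>

definition hypermap_iso :: "('a \<Rightarrow> 'b) \<Rightarrow> 'a hypermap \<Rightarrow> 'b hypermap \<Rightarrow> bool" where
  "hypermap_iso f A B \<longleftrightarrow> is_hypermap A \<and> is_hypermap B \<and>
     bij_betw f (flags A) (flags B) \<and> (\<forall>i. \<forall>y\<in>flags A. f (perm A i y) = perm B i (f y))"

lemma equivariant_fold:
  assumes "is_hypermap A" "\<And>i y. y \<in> flags A \<Longrightarrow> f (perm A i y) = perm B i (f y)"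
  shows "y \<in> flags A \<Longrightarrow> f (fold (perm A) w y) = fold (perm B) w (f y)"
  by (induction w arbitrary: y) (auto simp: assms perm_in_flags)

lemma hypermap_isoI:
  assumes A: "is_hypermap A" and f: "bij_betw f (flags A) (flags B)"
    and ext: "\<And>i. perm B i \<in> extensional (flags B)"
    and eqv: "\<And>i y. y \<in> flags A \<Longrightarrow> f (perm A i y) = perm B i (f y)"
  shows "hypermap_iso f A B"
proof -
  have img: "flags B = f ` flags A" using f by (simp add: bij_betw_def)
  have "is_hypermap B"
  proof (rule is_hypermapI[OF _ _ ext])
    show "finite (flags B)" "flags B \<noteq> {}" using A by (auto simp: img is_hypermap_def)
    fix i x assume "x \<in> flags B"
    then obtain y where y: "y \<in> flags A" "x = f y" by (auto simp: img)
    then have *: "perm B i x = f (perm A i y)" by (simp add: eqv)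
    with y show "perm B i x \<in> flags B" using perm_in_flags[OF A] by (auto simp: img)
    show "perm B i (perm B i x) = x"
      using A y * by (simp flip: eqv add: perm_in_flags) (simp add: is_hypermap_def)
    show "perm B i x \<noteq> x"
      using A y * f perm_in_flags[OF A y(1), of i]
      by (auto simp: is_hypermap_def bij_betw_def inj_on_eq_iff)
  next
    fix x y assume "x \<in> flags B" "y \<in> flags B"
    then obtain x' y' where "x' \<in> flags A" "x = f x'" "y' \<in> flags A" "y = f y'"
      by (auto simp: img)
    then show "\<exists>w. fold (perm B) w x = y"
      by (metis A eqv equivariant_fold hypermap_transitive)
  qed
  with A f eqv show ?thesis by (auto simp: hypermap_iso_def)
qed

lemma hypermap_iso_sym:
  assumes "hypermap_iso f A B"
  shows "hypermap_iso (inv_into (flags A) f) B A"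
proof -
  let ?g = "inv_into (flags A) f"
  have A: "is_hypermap A" and B: "is_hypermap B" and f: "bij_betw f (flags A) (flags B)"
    and eqv: "\<And>i y. y \<in> flags A \<Longrightarrow> f (perm A i y) = perm B i (f y)"
    using assms by (auto simp: hypermap_iso_def)
  have g: "bij_betw ?g (flags B) (flags A)" by (rule bij_betw_inv_into[OF f])
  have "?g (perm B i y) = perm A i (?g y)" if "y \<in> flags B" for i y
  proof -
    have "?g y \<in> flags A" "f (?g y) = y"
      using that g f by (auto simp: bij_betw_def f_inv_into_f)
    then show ?thesis
      using f eqv perm_in_flags[OF A] by (metis bij_betw_inv_into_left)
  qed
  with A B g show ?thesis by (simp add: hypermap_iso_def)
qed

context
  fixes f :: "'a \<Rightarrow> 'b" and A B
  assumes iso: "hypermap_iso f A B"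
begin

lemma iso_flags: "flags B = f ` flags A"
  using iso by (auto simp: hypermap_iso_def bij_betw_def)

lemma iso_inj: "inj_on f (flags A)"
  using iso by (auto simp: hypermap_iso_def bij_betw_def)

lemma iso_hypermaps: "is_hypermap A" "is_hypermap B"
  using iso by (auto simp: hypermap_iso_def)

lemma iso_fold: "y \<in> flags A \<Longrightarrow> f (fold (perm A) w y) = fold (perm B) w (f y)"
  using iso equivariant_fold[of A f B] by (simp add: hypermap_iso_def)

lemma iso_act: "y \<in> flags A \<Longrightarrow> act B (f y) g = f (act A y g)"
  by (simp add: act_def iso_fold)

lemma iso_hypermap_subgroup:
  "y \<in> flags A \<Longrightarrow> hypermap_subgroup B (f y) = hypermap_subgroup A y"
  using inj_on_eq_iff[OF iso_inj] act_in_flags[OF iso_hypermaps(1)]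
  by (auto simp: mem_hypermap_subgroup iso_act)

lemma iso_bipartite: "bipartite A \<longleftrightarrow> bipartite B"
  by (auto simp: bipartite_def iso_flags iso_hypermap_subgroup)

lemma iso_bipartite_regular: "bipartite_regular A \<longleftrightarrow> bipartite_regular B"
  by (auto simp: bipartite_regular_def iso_flags iso_hypermap_subgroup)

lemma iso_faces: "faces B k = (`) f ` faces A k"
proof -
  have "face_at B k (f y) = f ` face_at A k y" if "y \<in> flags A" for y
    unfolding face_at_def setcompr_eq_image image_image iso_fold[OF that] ..
  then show ?thesis
    by (auto simp: faces_eq_face_at iso_hypermaps iso_flags)
qed

lemma face_subset_flags: "F \<in> faces A k \<Longrightarrow> F \<subseteq> flags A"
  using face_at_subset_flags[OF iso_hypermaps(1)]
  by (auto simp: faces_eq_face_at iso_hypermaps)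

lemma iso_valency: "F \<in> faces A k \<Longrightarrow> valency (f ` F) = valency F"
  using card_image[OF inj_on_subset[OF iso_inj face_subset_flags]]
  by (simp add: valency_def)

lemma iso_Delta0_orbits: "Delta0_orbits B = (`) f ` Delta0_orbits A"
proof -
  have "{act B (f y) g |g. g \<in> Delta0} = f ` {act A y g |g. g \<in> Delta0}" if "y \<in> flags A" for y
    using iso_act[OF that] by auto
  then show ?thesis unfolding Delta0_orbits_eq iso_flags image_image by (rule image_cong[OF HOL.refl])
qed

lemma Delta0_orbit_subset_flags: "O1 \<in> Delta0_orbits A \<Longrightarrow> O1 \<subseteq> flags A"
  using act_in_flags[OF iso_hypermaps(1)] by (auto simp: Delta0_orbits_eq)

lemma iso_subset_Delta0_orbit:
  assumes F: "F \<in> faces A k" and O1: "O1 \<in> Delta0_orbits A"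
  shows "f ` F \<subseteq> f ` O1 \<longleftrightarrow> F \<subseteq> O1"
proof -
  have "f y \<in> f ` O1 \<longleftrightarrow> y \<in> O1" if "y \<in> F" for y
    using that face_subset_flags[OF F]
    by (intro inj_on_image_mem_iff[OF iso_inj _ Delta0_orbit_subset_flags[OF O1]]) auto
  then show ?thesis by (auto simp: image_subset_iff)
qed

lemma iso_hypervertex_valency:
  "O1 \<in> Delta0_orbits A \<Longrightarrow>
    (\<forall>F\<in>hypervertices B. F \<subseteq> f ` O1 \<longrightarrow> valency F = l) \<longleftrightarrow>
    (\<forall>F\<in>hypervertices A. F \<subseteq> O1 \<longrightarrow> valency F = l)"
  by (auto simp: iso_faces iso_valency iso_subset_Delta0_orbit)

lemma iso_bipartite_uniform:
  assumes "bipartite_uniform A l1 l2 m n"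
  shows "bipartite_uniform B l1 l2 m n"
proof -
  obtain O1 O2 where orb: "Delta0_orbits A = {O1, O2}" "O1 \<noteq> O2"
    and val: "\<forall>F\<in>hypervertices A. F \<subseteq> O1 \<longrightarrow> valency F = l1"
      "\<forall>F\<in>hypervertices A. F \<subseteq> O2 \<longrightarrow> valency F = l2"
    using assms unfolding bipartite_uniform_def by (elim conjE exE) (rule that)
  have "f ` O1 \<noteq> f ` O2"
    using orb inj_on_image_eq_iff[OF iso_inj] Delta0_orbit_subset_flags by simp
  moreover have "Delta0_orbits B = {f ` O1, f ` O2}" by (simp add: iso_Delta0_orbits orb)
  moreover have "\<forall>F\<in>hypervertices B. F \<subseteq> f ` O1 \<longrightarrow> valency F = l1"
    "\<forall>F\<in>hypervertices B. F \<subseteq> f ` O2 \<longrightarrow> valency F = l2"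
    using val orb by (simp_all add: iso_hypervertex_valency)
  ultimately have "\<exists>P Q. Delta0_orbits B = {P, Q} \<and> P \<noteq> Q \<and>
      (\<forall>F\<in>hypervertices B. F \<subseteq> P \<longrightarrow> valency F = l1) \<and>
      (\<forall>F\<in>hypervertices B. F \<subseteq> Q \<longrightarrow> valency F = l2)"
    by (intro exI[of _ "f ` O1"] exI[of _ "f ` O2"] conjI)
  moreover have "(\<forall>F\<in>faces B k. valency F = v) \<longleftrightarrow> (\<forall>F\<in>faces A k. valency F = v)" for k v
    by (simp add: iso_faces iso_valency)
  ultimately show ?thesis
    using assms iso_bipartite unfolding bipartite_uniform_def by simp
qed

end

text \<open>
  Under the isomorphism, a flag \<open>y\<close> corresponds to the set of group elements that carry the base flag \<open>b\<close> to \<open>y\<close>, which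
  is a right coset of the stabiliser of \<open>b\<close>.
\<close>

lemma hypermap_iso_coset_hypermap:
  assumes M: "is_hypermap M" and b: "b \<in> flags M"
  shows "hypermap_iso (\<lambda>y. {g. act M b g = y}) M (coset_hypermap (hypermap_subgroup M b))"
proof (rule hypermap_isoI[OF M])
  interpret D: group Delta by (rule group_Delta)
  let ?K = "hypermap_subgroup M b" and ?f = "\<lambda>y. {g. act M b g = y}"
  have coset: "?K #>\<^bsub>Delta\<^esub> g = ?f (act M b g)" for g
  proof
    show "?K #>\<^bsub>Delta\<^esub> g \<subseteq> ?f (act M b g)"
      by (auto simp: r_coset_def mem_hypermap_subgroup act_mult[OF M b])
    show "?f (act M b g) \<subseteq> ?K #>\<^bsub>Delta\<^esub> g"
    proof
      fix h assume "h \<in> ?f (act M b g)"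
      then have "h \<otimes>\<^bsub>Delta\<^esub> inv\<^bsub>Delta\<^esub> g \<in> ?K"
        by (simp add: mem_hypermap_subgroup act_mult[OF M b] act_inv[OF M b])
      moreover have "h = h \<otimes>\<^bsub>Delta\<^esub> inv\<^bsub>Delta\<^esub> g \<otimes>\<^bsub>Delta\<^esub> g" by (simp add: D.m_assoc)
      ultimately show "h \<in> ?K #>\<^bsub>Delta\<^esub> g" unfolding r_coset_def by blast
    qed
  qed
  have ex: "\<exists>g. act M b g = y" if "y \<in> flags M" for y
    using hypermap_transitive[OF M b that] act_word[OF M b] by metis
  show "bij_betw ?f (flags M) (flags (coset_hypermap ?K))"
    unfolding bij_betw_def
  proof
    show "inj_on ?f (flags M)" using ex by (fastforce simp: inj_on_def)
    have "flags (coset_hypermap ?K) = range (\<lambda>g. ?f (act M b g))"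
      by (auto simp: coset_hypermap_def RCOSETS_def coset)
    moreover have "range (act M b) = flags M"
      using ex act_in_flags[OF M b] by auto
    ultimately show "?f ` flags M = flags (coset_hypermap ?K)" by (metis image_image)
  qed
  fix i
  show "perm (coset_hypermap ?K) i \<in> extensional (flags (coset_hypermap ?K))"
    by (simp add: coset_hypermap_def)
  fix y assume "y \<in> flags M"
  then obtain g where g: "y = act M b g" using ex by auto
  have "perm (coset_hypermap ?K) i (?f y) = ?K #>\<^bsub>Delta\<^esub> (g \<otimes>\<^bsub>Delta\<^esub> R i)"
    using fold_perm_coset_hypermap[OF subgroup_hypermap_subgroup[OF M b], of "[i]" g]
    by (simp add: g coset R_def)
  also have "\<dots> = ?f (perm M i y)"
    by (simp add: g coset act_mult[OF M b] act_R[OF M] act_in_flags[OF M b])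
  finally show "?f (perm M i y) = perm (coset_hypermap ?K) i (?f y)" by simp
qed

section \<open>A concrete model of the Pin construction\<close>

text \<open>
  The flag \<open>(y, False)\<close> stands for the coset of an even \<open>g\<close> that carries the base flag to \<open>y\<close>
  through \<open>phi_P\<close>, and \<open>(y, True)\<close> for the coset of \<open>g R\<^sub>0\<close>. On the second sheet
  \<open>R\<^sub>1\<close> and \<open>R\<^sub>2\<close> both act as \<open>R\<^sub>0\<close> does on \<open>H\<close>, because \<open>g R\<^sub>0 R\<^sub>i = g R\<^sub>i\<^bsup>R\<^sub>0\<^esup> R\<^sub>0\<close> and
  \<open>phi_P\<close> sends the conjugate to \<open>R\<^sub>0\<close>.
\<close>

definition pin_model :: "'a hypermap \<Rightarrow> ('a \<times> bool) hypermap" where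
  "pin_model H =
     \<lparr>flags = flags H \<times> UNIV,
      perm = (\<lambda>i. \<lambda>(y, s)\<in>flags H \<times> UNIV.
        if i = I0 then (y, \<not> s) else (perm H (if s then I0 else i) y, s))\<rparr>"

lemma flags_pin_model [simp]: "flags (pin_model H) = flags H \<times> UNIV"
  by (simp add: pin_model_def)

lemma perm_pin_model:
  "y \<in> flags H \<Longrightarrow> perm (pin_model H) i (y, s) =
    (if i = I0 then (y, \<not> s) else (perm H (if s then I0 else i) y, s))"
  by (simp add: pin_model_def)

lemma fold_perm_pin_model:
  assumes H: "is_hypermap H"
  shows "y \<in> flags H \<Longrightarrow> fold (perm (pin_model H)) w (y, s) =
    (fold (perm H) (pin_word s w) y, if even0 w then s else \<not> s)"
  by (induction w arbitrary: y s) (auto simp: perm_pin_model perm_in_flags[OF H])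

lemma is_hypermap_pin_model:
  assumes H: "is_hypermap H"
  shows "is_hypermap (pin_model H)"
proof (rule is_hypermapI)
  show "finite (flags (pin_model H))" "flags (pin_model H) \<noteq> {}"
    using H by (auto simp: is_hypermap_def)
  show "perm (pin_model H) i \<in> extensional (flags (pin_model H))" for i
    by (simp add: pin_model_def)
  fix i p assume "p \<in> flags (pin_model H)"
  then obtain y s where p: "p = (y, s)" and y: "y \<in> flags H" by auto
  show "perm (pin_model H) i p \<in> flags (pin_model H)"
    "perm (pin_model H) i (perm (pin_model H) i p) = p"
    "perm (pin_model H) i p \<noteq> p"
    using H y perm_in_flags[OF H y] by (auto simp: p perm_pin_model is_hypermap_def)
next
  fix p q assume "p \<in> flags (pin_model H)" "q \<in> flags (pin_model H)"
  then obtain y s z t where p: "p = (y, s)" "y \<in> flags H" and q: "q = (z, t)" "z \<in> flags H"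
    by (cases p; cases q; auto)
  obtain v where v: "fold (perm H) v y = z" by (rule hypermap_transitive[OF H p(2) q(2)])
  obtain u where u: "even0 u" "pin_word False u = v" using pin_elt_surj by blast
  \<comment> \<open>Words lift most easily on the sheet \<open>False\<close>, so switch to it first and leave it at the end.\<close>
  let ?w = "(if s then [I0] else []) @ u @ (if t then [I0] else [])"
  have "fold (perm (pin_model H)) ?w p = q"
    using u v by (auto simp: p q fold_perm_pin_model[OF H p(2)] pin_word_append simp del: fold_append)
  then show "\<exists>w. fold (perm (pin_model H)) w p = q" ..
qed

lemma act_pin_model:
  assumes "is_hypermap H" "y \<in> flags H"
  shows "act (pin_model H) (y, False) g = (act H y (pin_elt g), \<not> even_elt g)"
  using assms by (cases g rule: word_cases)
    (simp add: act_word is_hypermap_pin_model fold_perm_pin_model pin_elt_word)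

lemma snd_act_pin_model:
  assumes "is_hypermap H" "y \<in> flags H"
  shows "snd (act (pin_model H) (y, s) g) = (if even_elt g then s else \<not> s)"
  using assms by (cases g rule: word_cases)
    (simp add: act_word is_hypermap_pin_model fold_perm_pin_model)

lemma phi_P_eq: "g \<in> Delta0 \<Longrightarrow> phi_P g = pin_elt g"
  using ex1_phi_P is_phi_P_phi_P is_phi_P_pin_elt by (metis restrict_apply')

lemma hypermap_iso_Pin:
  assumes H: "is_hypermap H" and x: "x \<in> flags H"
  shows "\<exists>f. hypermap_iso f (pin_model H) (Pin H x)"
proof -
  have "{g \<in> Delta0. phi_P g \<in> hypermap_subgroup H x} = hypermap_subgroup (pin_model H) (x, False)"
    by (auto simp: mem_hypermap_subgroup act_pin_model[OF H x] mem_Delta0_iff phi_P_eq)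
  then show ?thesis
    using hypermap_iso_coset_hypermap[OF is_hypermap_pin_model[OF H], of "(x, False)"] x
    by (auto simp: Pin_def)
qed

lemma Delta0_orbit_at_pin_model:
  assumes H: "is_hypermap H" and y: "y \<in> flags H"
  shows "{act (pin_model H) (y, s) g |g. g \<in> Delta0} = flags H \<times> {s}" (is "?O = _")
proof
  note M = is_hypermap_pin_model[OF H]
  show "?O \<subseteq> flags H \<times> {s}"
  proof
    fix p assume "p \<in> ?O"
    then obtain g where g: "p = act (pin_model H) (y, s) g" "g \<in> Delta0" by auto
    have "p \<in> flags H \<times> UNIV" using act_in_flags[OF M, of "(y, s)" g] y g by simp
    moreover have "snd p = s" using snd_act_pin_model[OF H y, of s g] g by (simp add: mem_Delta0_iff)
    ultimately show "p \<in> flags H \<times> {s}" by auto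
  qed
  show "flags H \<times> {s} \<subseteq> ?O"
  proof
    fix p assume p: "p \<in> flags H \<times> {s}"
    then obtain w where "fold (perm (pin_model H)) w (y, s) = p"
      using hypermap_transitive[OF M, of "(y, s)" p] y by auto
    then have w: "act (pin_model H) (y, s) (word w) = p" using y by (simp add: act_word[OF M])
    \<comment> \<open>Only even elements return to the sheet they started from.\<close>
    then have "word w \<in> Delta0"
      using snd_act_pin_model[OF H y, of s "word w"] p by (auto simp: mem_Delta0_iff split: if_splits)
    with w show "p \<in> ?O" by auto
  qed
qed

lemma Delta0_orbits_pin_model:
  assumes H: "is_hypermap H"
  shows "Delta0_orbits (pin_model H) = {flags H \<times> {False}, flags H \<times> {True}}"
proof -
  have "Delta0_orbits (pin_model H) = (\<lambda>p. flags H \<times> {snd p}) ` (flags H \<times> UNIV)"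
    unfolding Delta0_orbits_eq flags_pin_model
  proof (rule image_cong)
    fix p assume "p \<in> flags H \<times> (UNIV :: bool set)"
    then show "{act (pin_model H) p g |g. g \<in> Delta0} = flags H \<times> {snd p}"
      using Delta0_orbit_at_pin_model[OF H, of "fst p" "snd p"] by (simp add: mem_Times_iff)
  qed simp
  also have "\<dots> = (\<lambda>s. flags H \<times> {s}) ` snd ` (flags H \<times> UNIV)"
    by (simp only: image_image)
  also have "snd ` (flags H \<times> UNIV) = (UNIV :: bool set)"
    using H by (simp add: is_hypermap_def)
  finally show ?thesis by (simp add: UNIV_bool)
qed

lemma bipartite_pin_model:
  assumes H: "is_hypermap H"
  shows "bipartite (pin_model H)"
proof -
  have "even_elt g" if "y \<in> flags H" "act (pin_model H) (y, s) g = (y, s)" for y s g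
    using snd_act_pin_model[OF H that(1), of s g] that(2) by (auto split: if_splits)
  then show ?thesis
    by (auto simp: bipartite_def mem_hypermap_subgroup mem_Delta0_iff)
qed

section \<open>Faces of the model\<close>

lemma hypervertex_at_False:
  assumes H: "is_hypermap H" and y: "y \<in> flags H"
  shows "face_at (pin_model H) I0 (y, False) = face_at H I0 y \<times> {False}"
proof -
  have "pin_word False w = w \<and> even0 w" if "I0 \<notin> set w" for w
    using that by (induction w) auto
  then show ?thesis
    by (auto simp: face_at_def fold_perm_pin_model[OF H y]) (metis fold_perm_pin_model[OF H y])
qed

lemma hypervertex_at_True:
  assumes H: "is_hypermap H" and y: "y \<in> flags H"
  shows "face_at (pin_model H) I0 (y, True) = {(y, True), (perm H I0 y, True)}"
proof
  have y': "perm H I0 y \<in> flags H" "perm H I0 (perm H I0 y) = y"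
    using H y perm_in_flags[OF H y] by (auto simp: is_hypermap_def)
  show "face_at (pin_model H) I0 (y, True) \<subseteq> {(y, True), (perm H I0 y, True)}"
    by (rule face_at_least) (auto simp: perm_pin_model y y')
  show "{(y, True), (perm H I0 y, True)} \<subseteq> face_at (pin_model H) I0 (y, True)"
    using face_at_closed[OF face_at_refl, of I1 I0 "pin_model H" "(y, True)"]
    by (auto simp: face_at_refl perm_pin_model y)
qed

text \<open>
  A hyperedge or hyperface of the model covers both sheets over a face of \<open>H\<close>: \<open>R\<^sub>0\<close> switches
  sheets, and the action of \<open>R\<^sub>0\<close> on \<open>H\<close> is recovered by crossing to the sheet \<open>True\<close>, applying
  the other available generator there, and coming back.
\<close>

lemma face_at_pin_model:
  assumes H: "is_hypermap H" and y: "y \<in> flags H" and k: "k \<noteq> I0"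
  shows "face_at (pin_model H) k (y, s) = face_at H k y \<times> UNIV"
proof
  note sub = face_at_subset_flags[OF H y, of k]
  show "face_at (pin_model H) k (y, s) \<subseteq> face_at H k y \<times> UNIV"
  proof (rule face_at_least)
    fix p i assume "p \<in> face_at H k y \<times> (UNIV :: bool set)" "i \<noteq> k"
    with k sub show "perm (pin_model H) i p \<in> face_at H k y \<times> UNIV"
      by (cases p) (auto simp: perm_pin_model subset_iff intro: face_at_closed)
  qed (simp add: face_at_refl)
  let ?F = "face_at (pin_model H) k (y, s)"
  have step: "perm (pin_model H) i p \<in> ?F" if "p \<in> ?F" "i \<noteq> k" for p i
    using that by (rule face_at_closed)
  have switch: "(z, \<not> t) \<in> ?F" if "(z, t) \<in> ?F" "z \<in> flags H" for z t
    using step[OF that(1), of I0] k that(2) by (simp add: perm_pin_model)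
  have start: "(y, False) \<in> ?F"
    using face_at_refl[of "(y, s)" "pin_model H" k] switch[of y s] y by (cases s) auto
  obtain j where j: "j \<noteq> I0" "j \<noteq> k" by (metis idx.distinct(1,3,5))
  have "face_at H k y \<subseteq> {z \<in> flags H. (z, False) \<in> ?F}"
  proof (rule face_at_least)
    show "y \<in> {z \<in> flags H. (z, False) \<in> ?F}" using y start by simp
    fix z i assume "z \<in> {z \<in> flags H. (z, False) \<in> ?F}" and i: "i \<noteq> k"
    then have z: "z \<in> flags H" "(z, False) \<in> ?F" by auto
    have z': "perm H i z \<in> flags H" by (rule perm_in_flags[OF H z(1)])
    have "(perm H i z, False) \<in> ?F"
    proof (cases "i = I0")
      case False
      then show ?thesis using step[OF z(2) i] z(1) by (simp add: perm_pin_model)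
    next
      case True
      have "(z, True) \<in> ?F" using switch[OF z(2,1)] by simp
      then have "(perm H I0 z, True) \<in> ?F"
        using step[of "(z, True)" j] j z(1) by (simp add: perm_pin_model)
      then show ?thesis using switch[of "perm H I0 z" True] z' True by simp
    qed
    with z' show "perm H i z \<in> {z \<in> flags H. (z, False) \<in> ?F}" by simp
  qed
  then show "face_at H k y \<times> UNIV \<subseteq> ?F"
    using switch[of _ False] by (auto simp: subset_iff) (metis (full_types))
qed

lemma valency_face_at_pin_model:
  assumes "is_hypermap H" "y \<in> flags H" "k \<noteq> I0"
  shows "valency (face_at (pin_model H) k (y, s)) = 2 * valency (face_at H k y)"
  using even_card_face_at[OF assms(1,2), of k]
  by (simp add: valency_def face_at_pin_model[OF assms] card_cartesian_product)

lemma valency_hypervertex_at_False: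
  assumes "is_hypermap H" "y \<in> flags H"
  shows "valency (face_at (pin_model H) I0 (y, False)) = valency (face_at H I0 y)"
  by (simp add: valency_def hypervertex_at_False[OF assms] card_cartesian_product)

lemma valency_hypervertex_at_True:
  assumes "is_hypermap H" "y \<in> flags H"
  shows "valency (face_at (pin_model H) I0 (y, True)) = 1"
proof -
  have "perm H I0 y \<noteq> y" using assms by (auto simp: is_hypermap_def)
  then show ?thesis by (auto simp: valency_def hypervertex_at_True[OF assms])
qed

text \<open>
  \<open>R\<^sub>1\<close> and \<open>R\<^sub>2\<close> preserve each sheet, so the hypervertices inside a sheet are exactly those through
  its flags.
\<close>

lemma hypervertices_in_sheet:
  assumes H: "is_hypermap H"
  shows "(\<forall>F\<in>hypervertices (pin_model H). F \<subseteq> flags H \<times> {s} \<longrightarrow> P F) \<longleftrightarrow>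
    (\<forall>y\<in>flags H. P (face_at (pin_model H) I0 (y, s)))"
proof -
  have "face_at (pin_model H) I0 (y, t) \<subseteq> flags H \<times> {s} \<longleftrightarrow> t = s" if y: "y \<in> flags H" for y t
  proof -
    have "face_at (pin_model H) I0 (y, t) \<subseteq> flags H \<times> {t}"
      using y face_at_subset_flags[OF H y, of I0] perm_in_flags[OF H y]
      by (cases t) (auto simp: hypervertex_at_True[OF H y] hypervertex_at_False[OF H y])
    then show ?thesis using face_at_refl[of "(y, t)" "pin_model H" I0] by blast
  qed
  then show ?thesis
    by (auto simp: faces_eq_face_at[OF is_hypermap_pin_model[OF H]])
qed

lemma hypervertices_True_sheet:
  assumes "is_hypermap H"
  shows "\<forall>F\<in>hypervertices (pin_model H). F \<subseteq> flags H \<times> {True} \<longrightarrow> valency F = 1"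
  using assms by (simp add: hypervertices_in_sheet valency_hypervertex_at_True)

section \<open>Uniformity and regularity of the model\<close>

text \<open>
  The definition of bipartite-uniformity does not fix which orbit carries the smaller valency.
  If the valency \<open>1\<close> is assigned to the sheet \<open>False\<close>, then \<open>l = 1\<close> because the other sheet
  always has valency \<open>1\<close>; hence the sheet \<open>False\<close> has valency \<open>l\<close> in either case.
\<close>

lemma uniform_iff_bipartite_uniform_pin_model:
  assumes H: "is_hypermap H"
  shows "uniform H l m n \<longleftrightarrow> bipartite_uniform (pin_model H) 1 l (2 * m) (2 * n)"
proof -
  let ?F0 = "flags H \<times> {False}" and ?F1 = "flags H \<times> {True}"
  note M = is_hypermap_pin_model[OF H]
  obtain y0 where y0: "y0 \<in> flags H" using H by (auto simp: is_hypermap_def)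
  have faces: "(\<forall>F\<in>faces (pin_model H) k. valency F = 2 * v) \<longleftrightarrow>
      (\<forall>F\<in>faces H k. valency F = v)" if "k \<noteq> I0" for k v
    using that by (auto simp: faces_eq_face_at H M valency_face_at_pin_model)
  have val: "(\<forall>F\<in>hypervertices (pin_model H). F \<subseteq> ?F0 \<longrightarrow> valency F = v) \<longleftrightarrow>
      (\<forall>F\<in>hypervertices H. valency F = v)" for v
    by (auto simp: hypervertices_in_sheet[OF H] faces_eq_face_at[OF H] valency_hypervertex_at_False[OF H])
  have val1: "(\<forall>F\<in>hypervertices (pin_model H). F \<subseteq> ?F1 \<longrightarrow> valency F = v) \<longleftrightarrow> v = 1" for v
    using y0 by (auto simp: hypervertices_in_sheet[OF H] valency_hypervertex_at_True[OF H])
  have "(1 \<le> l \<and> (\<exists>A B. Delta0_orbits (pin_model H) = {A, B} \<and> A \<noteq> B \<and>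
        (\<forall>F\<in>hypervertices (pin_model H). F \<subseteq> A \<longrightarrow> valency F = 1) \<and>
        (\<forall>F\<in>hypervertices (pin_model H). F \<subseteq> B \<longrightarrow> valency F = l))) \<longleftrightarrow>
      (\<forall>F\<in>hypervertices H. valency F = l)" (is "?L \<longleftrightarrow> ?R")
  proof
    assume ?L
    then obtain A B where "Delta0_orbits (pin_model H) = {A, B}"
      and A: "\<forall>F\<in>hypervertices (pin_model H). F \<subseteq> A \<longrightarrow> valency F = 1"
      and B: "\<forall>F\<in>hypervertices (pin_model H). F \<subseteq> B \<longrightarrow> valency F = l"
      by (elim conjE exE) (rule that)
    then have "?F0 = A \<and> ?F1 = B \<or> ?F0 = B \<and> ?F1 = A"
      by (simp only: Delta0_orbits_pin_model[OF H] doubleton_eq_iff)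
    then consider "A = ?F0" "B = ?F1" | "A = ?F1" "B = ?F0" by metis
    then show ?R
    proof cases
      case 1
      have "l = 1" using B val1[of l] unfolding 1 by simp
      then show ?R using A val[of l] unfolding 1 by simp
    next
      case 2
      show ?R using B val[of l] unfolding 2 by simp
    qed
  next
    assume R: ?R
    have "1 \<le> l"
      using R valency_pos[OF H y0, of I0] y0 by (auto simp: faces_eq_face_at[OF H])
    moreover have "?F1 \<noteq> ?F0" using y0 by auto
    moreover have "Delta0_orbits (pin_model H) = {?F1, ?F0}"
      unfolding Delta0_orbits_pin_model[OF H] by (rule insert_commute)
    moreover have "\<forall>F\<in>hypervertices (pin_model H). F \<subseteq> ?F1 \<longrightarrow> valency F = 1"
      using val1[of 1] by simp
    moreover have "\<forall>F\<in>hypervertices (pin_model H). F \<subseteq> ?F0 \<longrightarrow> valency F = l"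
      using R val[of l] by simp
    ultimately show ?L by (intro conjI exI[of _ ?F1] exI[of _ ?F0])
  qed
  moreover have "(\<forall>F\<in>hyperedges (pin_model H). valency F = 2 * m) \<longleftrightarrow> (\<forall>F\<in>hyperedges H. valency F = m)"
    "(\<forall>F\<in>hyperfaces (pin_model H). valency F = 2 * n) \<longleftrightarrow> (\<forall>F\<in>hyperfaces H. valency F = n)"
    by (simp_all only: faces idx.distinct not_False_eq_True)
  ultimately show ?thesis
    using bipartite_pin_model[OF H] unfolding uniform_def bipartite_uniform_def by argo
qed

text \<open>
  Normality in \<open>Delta0\<close> compares the stabilisers of flags in one \<open>Delta0\<close>-orbit, hence on one
  sheet \<open>s\<close>, where a word \<open>w\<close> acts through \<open>pin_word s w\<close>.
\<close>

lemma bipartite_regular_pin_model_iff: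
  assumes H: "is_hypermap H"
  shows "bipartite_regular (pin_model H) \<longleftrightarrow>
    (\<forall>s. \<forall>y\<in>flags H. \<forall>z\<in>flags H. \<forall>w. even0 w \<longrightarrow>
      fold (perm H) (pin_word s w) y = y \<longrightarrow> fold (perm H) (pin_word s w) z = z)"
proof -
  note M = is_hypermap_pin_model[OF H]
  let ?S = "hypermap_subgroup (pin_model H)"
  have normal: "?S (y, s) \<lhd> Delta0_group \<longleftrightarrow> (\<forall>z\<in>flags H. ?S (y, s) \<subseteq> ?S (z, s))"
    if y: "y \<in> flags H" for y s
  proof -
    have "?S (y, s) \<subseteq> Delta0"
      using bipartite_pin_model[OF H] y by (simp add: bipartite_def)
    then have "?S (y, s) \<lhd> Delta0_group \<longleftrightarrow>
        (\<forall>g\<in>Delta0. ?S (y, s) \<subseteq> ?S (act (pin_model H) (y, s) g))"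
      using y by (intro hypermap_subgroup_normal_iff[OF M _ normal_imp_subgroup[OF Delta0_normal]]) auto
    also have "\<dots> \<longleftrightarrow>
        (\<forall>p\<in>{act (pin_model H) (y, s) g |g. g \<in> Delta0}. ?S (y, s) \<subseteq> ?S p)"
      by blast
    finally show ?thesis by (simp add: Delta0_orbit_at_pin_model[OF H y])
  qed
  have mem: "word w \<in> ?S (y, s) \<longleftrightarrow> even0 w \<and> fold (perm H) (pin_word s w) y = y"
    if "y \<in> flags H" for y s w
    using that by (auto simp: mem_hypermap_subgroup act_word[OF M] fold_perm_pin_model[OF H])
  have sub: "?S (y, s) \<subseteq> ?S (z, s) \<longleftrightarrow>
      (\<forall>w. even0 w \<longrightarrow> fold (perm H) (pin_word s w) y = y \<longrightarrow> fold (perm H) (pin_word s w) z = z)"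
    if "y \<in> flags H" "z \<in> flags H" for y z s
  proof -
    have "?S (y, s) \<subseteq> ?S (z, s) \<longleftrightarrow> (\<forall>w. word w \<in> ?S (y, s) \<longrightarrow> word w \<in> ?S (z, s))"
    proof (intro iffI allI subsetI)
      fix g assume "\<forall>w. word w \<in> ?S (y, s) \<longrightarrow> word w \<in> ?S (z, s)" "g \<in> ?S (y, s)"
      then show "g \<in> ?S (z, s)" by (cases g rule: word_cases) blast
    qed blast
    then show ?thesis using that by (simp add: mem imp_conjL)
  qed
  have "bipartite_regular (pin_model H) \<longleftrightarrow> (\<forall>s. \<forall>y\<in>flags H. ?S (y, s) \<lhd> Delta0_group)"
    unfolding bipartite_regular_def flags_pin_model by blast
  then show ?thesis by (simp only: normal sub cong: ball_cong)
qed

lemma regular_iff_bipartite_regular_pin_model: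
  assumes H: "is_hypermap H"
  shows "regular H \<longleftrightarrow> bipartite_regular (pin_model H)"
proof
  assume "regular H"
  then show "bipartite_regular (pin_model H)"
    unfolding bipartite_regular_pin_model_iff[OF H] regular_iff[OF H] by blast
next
  assume L: "bipartite_regular (pin_model H)"
  show "regular H"
    unfolding regular_iff[OF H]
  proof (intro ballI allI impI)
    fix y z w assume yz: "y \<in> flags H" "z \<in> flags H" and w: "fold (perm H) w y = y"
    \<comment> \<open>Surjectivity of \<open>phi_P\<close>: every word comes from an even word read on the sheet \<open>False\<close>.\<close>
    obtain u where "even0 u" "pin_word False u = w" using pin_elt_surj by blast
    with L w yz show "fold (perm H) w z = z"
      unfolding bipartite_regular_pin_model_iff[OF H] by blast
  qed
qed

theorem theorem12:
  fixes H :: "'a hypermap" and x :: 'a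
  assumes "is_hypermap H" and "x \<in> flags H"
  shows
    "(is_hypermap (Pin H x) \<and> bipartite (Pin H x) \<and>
        (\<exists>A\<in>Delta0_orbits (Pin H x). \<forall>F\<in>hypervertices (Pin H x). F \<subseteq> A \<longrightarrow> valency F = 1)) \<and>
     (\<forall>l m n. uniform H l m n \<longleftrightarrow> bipartite_uniform (Pin H x) 1 l (2 * m) (2 * n)) \<and>
     (regular H \<longleftrightarrow> bipartite_regular (Pin H x))"
proof -
  obtain f where f: "hypermap_iso f (pin_model H) (Pin H x)"
    using hypermap_iso_Pin[OF assms] by blast
  note g = hypermap_iso_sym[OF f]
  have sheet: "flags H \<times> {True} \<in> Delta0_orbits (pin_model H)"
    by (simp add: Delta0_orbits_pin_model[OF assms(1)])
  have "f ` (flags H \<times> {True}) \<in> Delta0_orbits (Pin H x)"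
    using sheet by (auto simp: iso_Delta0_orbits[OF f])
  moreover have "\<forall>F\<in>hypervertices (Pin H x). F \<subseteq> f ` (flags H \<times> {True}) \<longrightarrow> valency F = 1"
    using hypervertices_True_sheet[OF assms(1)] iso_hypervertex_valency[OF f sheet] by blast
  moreover have "is_hypermap (Pin H x)" "bipartite (Pin H x)"
    using iso_hypermaps[OF f] iso_bipartite[OF f] bipartite_pin_model[OF assms(1)] by simp_all
  moreover have "bipartite_uniform (pin_model H) 1 l m n \<longleftrightarrow> bipartite_uniform (Pin H x) 1 l m n" for l m n
    using iso_bipartite_uniform[OF f] iso_bipartite_uniform[OF g] by blast
  moreover have "bipartite_regular (pin_model H) \<longleftrightarrow> bipartite_regular (Pin H x)"
    by (rule iso_bipartite_regular[OF f])
  ultimately show ?thesis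
    unfolding uniform_iff_bipartite_uniform_pin_model[OF assms(1)]
      regular_iff_bipartite_regular_pin_model[OF assms(1)]
    by blast
qed

end
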